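(* There exists a constant $\varepsilon>0$ such that for strings $x,y\in\{0,1\}^n$, any deterministic $R$-pass streaming algorithm that approximates $\mathsf{ED}(x,y)$ within an additive error of $\varepsilon n$ needs $\Omega(n/R)$ space.
   Context: $\mathsf{ED}(x,y)$ is the edit distance (minimum number of single-character insertions, deletions and substitutions transforming $x$ into $y$). In the (standard) streaming model both input strings are given only through sequential (left-to-right) streaming access, read once per pass; space is the working memory of the algorithm. *)

theory Defs
  imports Complex_Main
begin

inductive edit_step :: "'a list \<Rightarrow> 'a list \<Rightarrow> bool" where
  insertion: "edit_step (u @ v) (u @ a # v)"
| deletion: "edit_step (u @ a # v) (u @ v)"
| substitution: "edit_step (u @ a # v) (u @ b # v)"

definition edit_distance :: "'a list \<Rightarrow> 'a list \<Rightarrow> nat" where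
  "edit_distance x y = (LEAST k. (edit_step ^^ k) x y)"

text \<open>
  A deterministic multi-pass streaming algorithm for inputs of a fixed length. The working memory
  is a bit string. The arguments of \<open>update\<close> are the index of the current pass, the position of
  the symbol being read, the symbol, and the current memory. Pass index and position are provided
  for free, and the functions are arbitrary (nonuniform); only the bits carried over from one
  symbol to the next count as space.
\<close>

record stream_alg =
  init :: "bool list"
  update :: "nat \<Rightarrow> nat \<Rightarrow> bool \<Rightarrow> bool list \<Rightarrow> bool list"
  result :: "bool list \<Rightarrow> real"

definition read_prefix :: "stream_alg \<Rightarrow> bool list \<Rightarrow> nat \<Rightarrow> nat \<Rightarrow> bool list \<Rightarrow> bool list" where
  "read_prefix A w p i m = fold (\<lambda>j. update A p j (w ! j)) [0..<i] m"

primrec after_passes :: "stream_alg \<Rightarrow> bool list \<Rightarrow> nat \<Rightarrow> bool list" where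
  "after_passes A w 0 = init A"
| "after_passes A w (Suc p) = read_prefix A w p (length w) (after_passes A w p)"

text \<open>Memory during pass \<open>p\<close> (counted from 0), once its first \<open>i\<close> symbols have been read.\<close>

definition memory :: "stream_alg \<Rightarrow> bool list \<Rightarrow> nat \<Rightarrow> nat \<Rightarrow> bool list" where
  "memory A w p i = read_prefix A w p i (after_passes A w p)"

text \<open>The input stream, read once from left to right in every pass, is \<open>x\<close> followed by \<open>y\<close>.\<close>

definition answer :: "stream_alg \<Rightarrow> nat \<Rightarrow> bool list \<Rightarrow> bool list \<Rightarrow> real" where
  "answer A R x y = result A (after_passes A (x @ y) R)"

definition space_bits :: "stream_alg \<Rightarrow> nat \<Rightarrow> nat \<Rightarrow> nat" where
  "space_bits A R n = Max {length (memory A (x @ y) p i) | x y p i.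
     length x = n \<and> length y = n \<and> p < R \<and> i \<le> length (x @ y)}"

definition approximates_ED :: "stream_alg \<Rightarrow> nat \<Rightarrow> nat \<Rightarrow> real \<Rightarrow> bool" where
  "approximates_ED A R n e \<longleftrightarrow>
     (\<forall>x y. length x = n \<and> length y = n \<longrightarrow>
        \<bar>answer A R x y - real (edit_distance x y)\<bar> \<le> e)"

end

theory Submission
  imports Defs
begin

text \<open>
  Run the algorithm on the inputs \<open>(x, x)\<close> and record the memory in the middle and at the end of
  each pass. If \<open>x\<close> and \<open>x'\<close> leave the same record, the algorithm cannot distinguish \<open>(x, x')\<close> from
  \<open>(x, x)\<close>, so \<open>x'\<close> lies in a ball of radius \<open>k \<le> n / 15\<close> around \<open>x\<close>. Such a ball has at most
  \<open>(5/4)^n * 32^k\<close> elements, whereas with \<open>s\<close> bits of space there are at most \<open>4^(2 R s)\<close> records;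
  hence \<open>2^n \<le> 4^(2 R s) * (5/4)^n * 32^k\<close>, which forces \<open>R s \<ge> n / 12\<close>.
\<close>

section \<open>Alignments\<close>

text \<open>Edits arranged from left to right: every rule acts at the heads only, which allows
  recursion on the strings. \<open>k\<close> is a budget rather than an exact count, as
  \<open>empty\<close> accepts every \<open>k\<close>.\<close>

inductive alignable :: "'a list \<Rightarrow> 'a list \<Rightarrow> nat \<Rightarrow> bool" where
  empty: "alignable [] [] k"
| match: "alignable x y k \<Longrightarrow> alignable (a # x) (a # y) k"
| subst: "alignable x y k \<Longrightarrow> alignable (a # x) (b # y) (Suc k)"
| del: "alignable x y k \<Longrightarrow> alignable (a # x) y (Suc k)"
| ins: "alignable x y k \<Longrightarrow> alignable x (b # y) (Suc k)"

lemma alignable_Suc: "alignable x y k \<Longrightarrow> alignable x y (Suc k)"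
  by (induction rule: alignable.induct) (auto intro: alignable.intros)

lemma alignable_refl: "alignable x x k"
  by (induction x) (auto intro: alignable.intros)

lemma edit_step_cases:
  assumes "edit_step x y"
  obtains a where "y = a # x" | a where "x = a # y"
  | a b v where "x = a # v" "y = b # v"
  | c u v where "x = c # u" "y = c # v" "edit_step u v"
  using assms
proof cases
  case (insertion u v a)
  then show ?thesis by (cases u) (auto intro: that edit_step.intros)
next
  case (deletion u a v)
  then show ?thesis by (cases u) (auto intro: that edit_step.intros)
next
  case (substitution u a v b)
  then show ?thesis by (cases u) (auto intro: that edit_step.intros)
qed

text \<open>An edit at the head is absorbed by the rules there; an edit further on is left to the
  induction hypothesis. After \<open>ins\<close> the left string is unchanged, so the edit is simply
  passed on.\<close>

lemma alignable_edit_step: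
  "alignable y z k \<Longrightarrow> edit_step x y \<Longrightarrow> alignable x z (Suc k)"
proof (induction arbitrary: x rule: alignable.induct)
  case (empty k)
  from empty.prems show ?case
    by (cases rule: edit_step_cases) (auto intro: alignable.intros)
next
  case (match v z k a)
  from match.prems match.hyps match.IH show ?case
    by (cases rule: edit_step_cases) (auto intro: alignable.intros)
next
  case (subst v z k a b)
  from subst.prems subst.hyps subst.IH show ?case
    by (cases rule: edit_step_cases)
      (auto intro: alignable.intros alignable_Suc)
next
  case (del v z k a)
  from del.prems del.hyps del.IH show ?case
    by (cases rule: edit_step_cases)
      (auto intro: alignable.intros alignable_Suc)
next
  case (ins y z k b)
  then show ?case by (auto intro: alignable.intros)
qed

lemma alignable_edit_steps: "(edit_step ^^ k) x y \<Longrightarrow> alignable x y k"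
proof (induction k arbitrary: x)
  case 0
  then show ?case by (simp add: alignable_refl)
next
  case (Suc k)
  then obtain w where "edit_step x w" "(edit_step ^^ k) w y"
    by (blast elim: relpowp_Suc_E2)
  with Suc.IH alignable_edit_step show ?case by blast
qed

text \<open>Delete all of \<open>x\<close>, then insert all of \<open>y\<close>. Hence the
  \<open>LEAST\<close> in \<open>edit_distance\<close> is attained.\<close>

lemma edit_steps_exist: "\<exists>k. (edit_step ^^ k) x y"
proof -
  have "(edit_step ^^ length x) x []"
  proof (induction x)
    case (Cons a x)
    have "edit_step (a # x) x" using deletion[of "[]" a x] by simp
    with Cons show ?case using relpowp_Suc_I2[of edit_step] by (simp del: relpowp.simps)
  qed simp
  moreover have "(edit_step ^^ length y) [] y"
  proof (induction y)
    case (Cons a y)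
    have "edit_step y (a # y)" using insertion[of "[]" y a] by simp
    with Cons show ?case by auto
  qed simp
  ultimately have "(edit_step ^^ (length x + length y)) x y"
    unfolding relpowp_add by blast
  then show ?thesis ..
qed

lemma edit_steps_edit_distance: "(edit_step ^^ edit_distance x y) x y"
  unfolding edit_distance_def by (rule LeastI_ex) (rule edit_steps_exist)

lemma edit_distance_refl: "edit_distance x x = 0"
  unfolding edit_distance_def by (rule Least_equality) auto

lemma alignable_edit_distance:
  assumes "edit_distance x y \<le> k"
  shows "alignable x y k"
  using assms
proof (induction k rule: dec_induct)
  case base
  show ?case by (rule alignable_edit_steps[OF edit_steps_edit_distance])
next
  case (step k)
  then show ?case by (blast intro: alignable_Suc)
qed

section \<open>The size of balls\<close>

text \<open>Contains the edit-distance ball of radius \<open>k\<close> by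
  \<open>alignable_edit_distance\<close>, so an upper bound on its size suffices.\<close>

definition ball :: "bool list \<Rightarrow> nat \<Rightarrow> bool list set" where
  "ball x k = {y. alignable x y k}"

lemma ball_Nil_0: "ball [] 0 = {[]}"
proof -
  have "y = []" if "alignable [] y 0" for y :: "bool list"
    using that by cases auto
  then show ?thesis by (auto simp: ball_def intro: alignable.empty)
qed

lemma ball_Nil_Suc:
  "ball [] (Suc k) \<subseteq> {[]} \<union> Cons True ` ball [] k \<union> Cons False ` ball [] k"
  (is "_ \<subseteq> ?R")
proof
  fix y assume "y \<in> ball [] (Suc k)"
  then have "alignable [] y (Suc k)" by (simp add: ball_def)
  then show "y \<in> ?R" by cases (auto simp: ball_def image_iff)
qed

lemma ball_Cons_0: "ball (a # x) 0 \<subseteq> Cons a ` ball x 0"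
  (is "_ \<subseteq> ?R")
proof
  fix y assume "y \<in> ball (a # x) 0"
  then have "alignable (a # x) y 0" by (simp add: ball_def)
  then show "y \<in> ?R" by cases (auto simp: ball_def image_iff)
qed

text \<open>The pieces come from the outermost rule: match, deletion, substitution, insertion.
  Insertion keeps \<open>a # x\<close> and lowers only \<open>k\<close>.\<close>

lemma ball_Cons_Suc:
  "ball (a # x) (Suc k) \<subseteq> Cons a ` ball x (Suc k) \<union> ball x k \<union>
     (Cons True ` ball x k \<union> Cons False ` ball x k) \<union>
     (Cons True ` ball (a # x) k \<union> Cons False ` ball (a # x) k)"
  (is "_ \<subseteq> ?R")
proof
  fix y assume "y \<in> ball (a # x) (Suc k)"
  then have "alignable (a # x) y (Suc k)" by (simp add: ball_def)
  then show "y \<in> ?R" by cases (auto simp: ball_def image_iff)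
qed

lemma card_Cons_image: "card (Cons a ` S) = card S"
  by (rule card_image) simp

lemma card_Un_Cons_le: "card (Cons True ` S \<union> Cons False ` S) \<le> 2 * card S"
  using card_Un_le[of "Cons True ` S" "Cons False ` S"] by (simp add: card_Cons_image)

text \<open>
  The bases 5/4 and 32 are chosen such that \<open>\<alpha> \<ge> 1 + (3 + 2 * \<alpha>) / \<beta>\<close>, which is what the recursion
  \<open>f (n+1) (k+1) = f n (k+1) + 3 * f n k + 2 * f (n+1) k\<close> requires of the bound \<open>\<alpha>^n * \<beta>^k\<close>.
\<close>

lemma finite_card_ball:
  "finite (ball x k) \<and> real (card (ball x k)) \<le> (5/4) ^ length x * 32 ^ k"
proof (induction x arbitrary: k)
  case Nil
  show ?case
  proof (induction k)
    case 0
    show ?case by (simp add: ball_Nil_0)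
  next
    case (Suc k)
    let ?U = "Cons True ` ball [] k \<union> Cons False ` ball [] k"
    have sub: "ball [] (Suc k) \<subseteq> {[]} \<union> ?U"
      using ball_Nil_Suc by auto
    have fin: "finite ({[]} \<union> ?U)" using Suc by auto
    have "card (ball [] (Suc k)) \<le> card ({[]} \<union> ?U)"
      by (rule card_mono[OF fin sub])
    also have "\<dots> \<le> 1 + 2 * card (ball [] k)"
      using card_Un_le[of "{[]}" ?U] card_Un_Cons_le[of "ball [] k"] by simp
    finally have "real (card (ball [] (Suc k))) \<le> 1 + 2 * real (card (ball [] k))"
      by linarith
    also have "\<dots> \<le> 1 + 2 * 32 ^ k" using Suc by simp
    also have "\<dots> \<le> 32 ^ Suc k"
      using one_le_power[of "32::real" k] unfolding power_Suc by linarith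
    finally show ?case using finite_subset[OF sub fin] by simp
  qed
next
  case (Cons a x)
  \<comment> \<open>Nested induction: the insertion piece has the same string and a smaller budget,
    the other pieces have the shorter \<open>x\<close>.\<close>
  show ?case
  proof (induction k)
    case 0
    have fin: "finite (Cons a ` ball x 0)" using Cons by simp
    have "card (ball (a # x) 0) \<le> card (ball x 0)"
      using card_mono[OF fin ball_Cons_0] by (simp add: card_Cons_image)
    also have "real \<dots> \<le> (5/4) ^ length x" using Cons[of 0] by simp
    also have "\<dots> \<le> (5/4) ^ length (a # x)" by simp
    finally show ?case using finite_subset[OF ball_Cons_0 fin] by simp
  next
    case (Suc k)
    let ?U = "Cons True ` ball x k \<union> Cons False ` ball x k"
    let ?V = "Cons True ` ball (a # x) k \<union> Cons False ` ball (a # x) k"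
    let ?W = "Cons a ` ball x (Suc k) \<union> ball x k \<union> ?U \<union> ?V"
    have fin: "finite ?W" using Suc Cons by simp
    have "card (ball (a # x) (Suc k)) \<le> card ?W"
      by (rule card_mono[OF fin ball_Cons_Suc])
    also have "\<dots> \<le> card (ball x (Suc k)) + card (ball x k) + card ?U + card ?V"
      using card_Un_le[of "Cons a ` ball x (Suc k) \<union> ball x k \<union> ?U" ?V]
        card_Un_le[of "Cons a ` ball x (Suc k) \<union> ball x k" ?U]
        card_Un_le[of "Cons a ` ball x (Suc k)" "ball x k"]
      by (simp only: card_Cons_image)
    finally have "card (ball (a # x) (Suc k)) \<le>
        card (ball x (Suc k)) + 3 * card (ball x k) + 2 * card (ball (a # x) k)"
      using card_Un_Cons_le[of "ball x k"] card_Un_Cons_le[of "ball (a # x) k"] by linarith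
    then have "real (card (ball (a # x) (Suc k))) \<le>
        real (card (ball x (Suc k))) + 3 * real (card (ball x k)) + 2 * real (card (ball (a # x) k))"
      by linarith
    also have "\<dots> \<le> (5/4) ^ length x * 32 ^ Suc k + 3 * ((5/4) ^ length x * 32 ^ k) +
        2 * ((5/4) ^ length (a # x) * 32 ^ k)"
      using Suc Cons[of k] Cons[of "Suc k"] by (intro add_mono mult_left_mono) auto
    \<comment> \<open>Dividing by \<open>(5/4) ^ length x * 32 ^ k\<close> leaves 32 + 3 + 5/2 \<le>
      40.\<close>
    also have "\<dots> \<le> (5/4) ^ length (a # x) * 32 ^ Suc k"
      by (simp add: field_simps)
    finally show ?case using finite_subset[OF ball_Cons_Suc fin] by simp
  qed
qed

section \<open>Indistinguishable inputs\<close>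

lemma after_passes_Suc_memory: "after_passes A w (Suc p) = memory A w p (length w)"
  by (simp add: memory_def)

text \<open>The right-hand side is free of \<open>y\<close>: the first half of a pass is determined
  by \<open>x\<close> and the starting memory.\<close>

lemma read_prefix_append_left:
  "read_prefix A (x @ y) p (length x) m = fold (\<lambda>j. update A p j (x ! j)) [0..<length x] m"
  unfolding read_prefix_def by (rule fold_cong) (auto simp: nth_append)

text \<open>In the second half, \<open>x\<close> enters only through its length and the memory at
  the midpoint.\<close>

lemma read_prefix_append:
  "read_prefix A (x @ y) p (length (x @ y)) m =
     fold (\<lambda>j. update A p j (y ! (j - length x))) [length x..<length x + length y]
       (read_prefix A (x @ y) p (length x) m)"
proof -
  have "[0..<length (x @ y)] = [0..<length x] @ [length x..<length x + length y]"
    using upt_add_eq_append[of 0 "length x" "length y"] by simp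
  then have "read_prefix A (x @ y) p (length (x @ y)) m =
      fold (\<lambda>j. update A p j ((x @ y) ! j)) [length x..<length x + length y]
        (read_prefix A (x @ y) p (length x) m)"
    by (simp add: read_prefix_def)
  also have "\<dots> = fold (\<lambda>j. update A p j (y ! (j - length x))) [length x..<length x + length y]
      (read_prefix A (x @ y) p (length x) m)"
    by (rule fold_cong) (auto simp: nth_append)
  finally show ?thesis .
qed

text \<open>Cut and paste within each pass: the first half runs as on \<open>x @ x\<close>,
  \<open>mid\<close> switches to the run on \<open>y @ y\<close> for the second half, and
  \<open>fin\<close> switches back before the next pass.\<close>

lemma after_passes_crossing:
  assumes len: "length x = n" "length y = n"
    and mid: "\<And>p. p < R \<Longrightarrow> memory A (x @ x) p n = memory A (y @ y) p n"
    and fin: "\<And>p. p < R \<Longrightarrow> memory A (x @ x) p (n + n) = memory A (y @ y) p (n + n)"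
  shows "p \<le> R \<Longrightarrow> after_passes A (x @ y) p = after_passes A (x @ x) p"
proof (induction p)
  case 0
  show ?case by simp
next
  case (Suc p)
  then have p: "p < R" and IH: "after_passes A (x @ y) p = after_passes A (x @ x) p"
    by simp_all
  have "memory A (x @ y) p n = memory A (x @ x) p n"
    unfolding memory_def IH
    using read_prefix_append_left[of A x x p] read_prefix_append_left[of A x y p] len by simp
  also have "\<dots> = memory A (y @ y) p n" by (rule mid[OF p])
  finally have half: "memory A (x @ y) p n = memory A (y @ y) p n" .
  have "memory A (x @ y) p (n + n) = memory A (y @ y) p (n + n)"
    using half read_prefix_append[of A x y p] read_prefix_append[of A y y p] len
    by (simp add: memory_def)
  also have "\<dots> = memory A (x @ x) p (n + n)" by (rule fin[OF p, symmetric])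
  finally show ?case
    using len by (simp only: after_passes_Suc_memory length_append)
qed

text \<open>Two blocks of fixed length \<open>R\<close>, so equal transcripts agree entry by
  entry.\<close>

definition transcript :: "stream_alg \<Rightarrow> nat \<Rightarrow> bool list \<Rightarrow> bool list list" where
  "transcript A R x = map (\<lambda>p. memory A (x @ x) p (length x)) [0..<R] @
     map (\<lambda>p. memory A (x @ x) p (length x + length x)) [0..<R]"

lemma answer_eq_if_transcript_eq:
  assumes "length x = n" "length y = n" "transcript A R x = transcript A R y"
  shows "answer A R x y = answer A R x x"
proof -
  have "after_passes A (x @ y) R = after_passes A (x @ x) R"
    using assms by (intro after_passes_crossing[where n = n and R = R]) (auto simp: transcript_def)
  then show ?thesis by (simp add: answer_def)
qed

lemma length_memory_le_space_bits:
  assumes "length x = n" "length y = n" "p < R" "i \<le> length (x @ y)"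
  shows "length (memory A (x @ y) p i) \<le> space_bits A R n"
proof -
  let ?L = "{x :: bool list. length x = n}"
  let ?M = "{length (memory A (x @ y) p i) | x y p i.
     length x = n \<and> length y = n \<and> p < R \<and> i \<le> length (x @ y)}"
  \<comment> \<open>\<open>Max_ge\<close> requires a finite set; \<open>?M\<close> lies in the image
    of a finite index set.\<close>
  have "?M \<subseteq> (\<lambda>(x, y, p, i). length (memory A (x @ y) p i)) ` (?L \<times> ?L \<times> {..<R} \<times> {..n + n})"
    by force
  moreover have "finite ?L"
    using finite_lists_length_eq[of "UNIV :: bool set" n] by simp
  ultimately have "finite ?M"
    by (elim finite_subset) simp
  then show ?thesis
    unfolding space_bits_def using assms by (intro Max_ge) blast+
qed

section \<open>The counting argument\<close>

text \<open>The sum is \<open>2 ^ (s + 1) - 1\<close>. Base 4 absorbs the shorter lengths with no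
  additive term in the exponent, so that later the exponent is a multiple of
  \<open>R * s\<close>.\<close>

lemma card_bool_lists_length_le: "card {m :: bool list. length m \<le> s} \<le> 4 ^ s"
proof -
  have "card {m :: bool list. length m \<le> s} = (\<Sum>i\<le>s. 2 ^ i)"
    using card_lists_length_le[of "UNIV :: bool set" s] by simp
  also have "\<dots> \<le> 4 ^ s"
  proof (induction s)
    case (Suc s)
    have "(2::nat) ^ s \<le> 4 ^ s" by (rule power_mono) simp_all
    with Suc show ?case unfolding sum.atMost_Suc power_Suc by linarith
  qed simp
  finally show ?thesis .
qed

lemma transcripts_bounded:
  fixes A R n
  defines "T \<equiv> transcript A R ` {x. length x = n}"
  shows "finite T \<and> card T \<le> 4 ^ (2 * R * space_bits A R n)"
proof -
  let ?B = "{m :: bool list. length m \<le> space_bits A R n}"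
  let ?S = "{t. set t \<subseteq> ?B \<and> length t = 2 * R}"
  have finB: "finite ?B"
    using finite_lists_length_le[of "UNIV :: bool set"] by simp
  have sub: "T \<subseteq> ?S"
    unfolding T_def by (auto simp: transcript_def intro!: length_memory_le_space_bits)
  have finS: "finite ?S" by (rule finite_lists_length_eq[OF finB])
  have "card T \<le> card ?S" by (rule card_mono[OF finS sub])
  also have "\<dots> = card ?B ^ (2 * R)" by (rule card_lists_length_eq[OF finB])
  also have "\<dots> \<le> (4 ^ space_bits A R n) ^ (2 * R)"
    by (rule power_mono[OF card_bool_lists_length_le]) simp
  also have "\<dots> = 4 ^ (2 * R * space_bits A R n)"
    by (simp add: power_mult[symmetric] mult.commute)
  finally show ?thesis using finite_subset[OF sub finS] by simp
qed

text \<open>The fibres of \<open>f\<close>, one for each value, cover \<open>S\<close>.\<close>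

lemma card_le_card_image_mult:
  fixes f :: "'a \<Rightarrow> 'b" and b :: real
  assumes "finite (f ` S)" and "\<And>x. x \<in> S \<Longrightarrow> real (card {y \<in> S. f y = f x}) \<le> b"
  shows "real (card S) \<le> real (card (f ` S)) * b"
proof -
  have "S = (\<Union>t\<in>f ` S. {y \<in> S. f y = t})" by auto
  then have "card S \<le> (\<Sum>t\<in>f ` S. card {y \<in> S. f y = t})"
    using card_UN_le[OF assms(1), of "\<lambda>t. {y \<in> S. f y = t}"] by simp
  then have "real (card S) \<le> (\<Sum>t\<in>f ` S. real (card {y \<in> S. f y = t}))"
    by (metis of_nat_le_iff of_nat_sum)
  also have "\<dots> \<le> real (card (f ` S)) * b"
    by (rule sum_bounded_above) (use assms(2) in auto)
  finally show ?thesis .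
qed

lemma space_times_passes_lower_bound:
  assumes approx: "approximates_ED A R n (real n / 30)"
  shows "n \<le> 12 * (R * space_bits A R n)"
proof -
  let ?S = "{x :: bool list. length x = n}"
  \<comment> \<open>Twice the error \<open>n / 30\<close>, rounded down because distances are
    integers.\<close>
  define k where "k = n div 15"
  define q where "q = R * space_bits A R n"
  have fibre: "{y \<in> ?S. transcript A R y = transcript A R x} \<subseteq> ball x k" if "x \<in> ?S" for x
  proof
    fix y assume y: "y \<in> {y \<in> ?S. transcript A R y = transcript A R x}"
    have "answer A R x y = answer A R x x"
      using that y by (intro answer_eq_if_transcript_eq[of _ n]) auto
    moreover have "\<bar>answer A R x y - real (edit_distance x y)\<bar> \<le> real n / 30"
      and "\<bar>answer A R x x - real (edit_distance x x)\<bar> \<le> real n / 30"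
      using approx that y by (auto simp: approximates_ED_def)
    \<comment> \<open>Triangle inequality: the common answer is close both to 0 and to the distance
      of \<open>x\<close> and \<open>y\<close>.\<close>
    ultimately have "15 * real (edit_distance x y) \<le> real n"
      unfolding edit_distance_refl by linarith
    then have "edit_distance x y \<le> k" unfolding k_def by linarith
    then show "y \<in> ball x k" by (simp add: ball_def alignable_edit_distance)
  qed
  have "real (card {y \<in> ?S. transcript A R y = transcript A R x}) \<le> (5/4) ^ n * 32 ^ k"
    if "x \<in> ?S" for x
  proof -
    have "card {y \<in> ?S. transcript A R y = transcript A R x} \<le> card (ball x k)"
      by (rule card_mono[OF _ fibre[OF that]]) (simp add: finite_card_ball)
    also have "real \<dots> \<le> (5/4) ^ n * 32 ^ k"
      using finite_card_ball[of x k] that by simp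
    finally show ?thesis by simp
  qed
  then have "real (card ?S) \<le> real (card (transcript A R ` ?S)) * ((5/4) ^ n * 32 ^ k)"
    using transcripts_bounded by (intro card_le_card_image_mult) auto
  also have "\<dots> \<le> 4 ^ (2 * q) * ((5/4) ^ n * 32 ^ k)"
  proof (rule mult_right_mono)
    have "card (transcript A R ` ?S) \<le> 4 ^ (2 * q)"
      using transcripts_bounded[of A R n] by (simp add: q_def mult.assoc)
    then show "real (card (transcript A R ` ?S)) \<le> 4 ^ (2 * q)"
      by (metis of_nat_le_iff of_nat_numeral of_nat_power)
  qed simp
  also have "real (card ?S) = 2 ^ n"
    using card_lists_length_eq[of "UNIV :: bool set" n] by simp
  finally have "(2::real) ^ n \<le> 4 ^ (2 * q) * ((5/4) ^ n * 32 ^ k)" .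
  \<comment> \<open>Splitting 2 as 8/5 times 5/4 lets the ball's factor \<open>(5/4) ^ n\<close>
    cancel.\<close>
  moreover have "(2::real) ^ n = (8/5) ^ n * (5/4) ^ n"
    by (simp add: power_mult_distrib[symmetric])
  moreover have "(4::real) ^ (2 * q) = 2 ^ (4 * q)" "(32::real) ^ k = 2 ^ (5 * k)"
    by (simp_all add: power_mult)
  ultimately have "(8/5 :: real) ^ n * (5/4) ^ n \<le> 2 ^ (4 * q + 5 * k) * (5/4) ^ n"
    by (simp add: power_add mult_ac)
  then have base: "(8/5 :: real) ^ n \<le> 2 ^ (4 * q + 5 * k)"
    by (rule mult_right_le_imp_le) simp
  \<comment> \<open>Cubing works because \<open>(8/5) ^ 3 = 4.096\<close> exceeds 4; both sides
    become powers of 2, whose exponents can be compared.\<close>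
  have "(2::real) ^ (2 * n) = 4 ^ n" by (simp add: power_mult)
  also have "\<dots> \<le> ((8/5) ^ 3) ^ n" by (rule power_mono) (simp_all add: power3_eq_cube)
  also have "\<dots> = ((8/5) ^ n) ^ 3" by (simp add: power_mult[symmetric] mult.commute)
  also have "\<dots> \<le> (2 ^ (4 * q + 5 * k)) ^ 3" by (rule power_mono[OF base]) simp
  also have "\<dots> = 2 ^ (3 * (4 * q + 5 * k))" by (simp add: power_mult[symmetric] mult.commute)
  finally have "2 * n \<le> 3 * (4 * q + 5 * k)" by simp
  moreover have "15 * k \<le> n" by (simp add: k_def)
  ultimately show ?thesis by (simp add: q_def)
qed

theorem theoremA1:
  "\<exists>\<epsilon>::real. \<epsilon> > 0 \<and>
     (\<exists>c::real. c > 0 \<and>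
       (\<forall>\<^sub>F n::nat in sequentially. \<forall>(R::nat) (A::stream_alg).
          R \<ge> 1 \<and> approximates_ED A R n (\<epsilon> * real n) \<longrightarrow>
          real (space_bits A R n) \<ge> c * (real n / real R)))"
proof (intro exI conjI always_eventually allI impI)
  fix n R A
  \<comment> \<open>The bound holds for every \<open>n\<close>. The witnesses are 1/30 for
    \<open>\<epsilon>\<close> and, in the last step, 1/12 for \<open>c\<close>.\<close>
  assume *: "R \<ge> 1 \<and> approximates_ED A R n (1/30 * real n)"
  then have "n \<le> 12 * (R * space_bits A R n)"
    by (intro space_times_passes_lower_bound) simp
  then have "real n \<le> 12 * (real R * real (space_bits A R n))"
    by (metis of_nat_le_iff of_nat_mult of_nat_numeral)
  with * show "1/12 * (real n / real R) \<le> real (space_bits A R n)"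
    by (simp add: field_simps)
qed simp_all

end
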